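(* Let $p=1$, $m>0$ and $A=[-m,m]$, i.e. the parameter space is $\{\theta=(\theta_1,\theta_2)\in\mathbb{R}^2:|\theta_1-\theta_2|\le m\}$. For estimating the density of $Y_1$ under Kullback-Leibler loss, the Bayes predictive density $\hat q_{\pi_{U,A}}$ (strictly) dominates the minimum risk equivariant predictive density estimator $\hat q_{\mathrm{mre}}$.
   Context: Model: $X=(X_1,X_2)$ and $Y_1$, with $X_1\sim N(\theta_1,\sigma_1^2)$, $X_2\sim N(\theta_2,\sigma_2^2)$, $Y_1\sim N(\theta_1,\sigma_Y^2)$ independent, where $\sigma_1^2,\sigma_2^2,\sigma_Y^2>0$ are known and $\theta_1-\theta_2\in A$. Let $q_{\theta_1}$ be the density of $Y_1$. A predictive density is a density $\hat q(\cdot;X)$ on $\mathbb{R}$ depending on $X$, used to estimate $q_{\theta_1}$. Kullback-Leibler loss is $L(\theta,\hat q)=\int q_{\theta_1}(y)\log\frac{q_{\theta_1}(y)}{\hat q(y;x)}\,dy$, and the Kullback-Leibler risk is $R_{KL}(\theta,\hat q)=\mathbb{E}_\theta[L(\theta,\hat q(\cdot;X))]$. A predictive density $\hat q_a$ dominates $\hat q_b$ if $R_{KL}(\theta,\hat q_a)\le R_{KL}(\theta,\hat q_b)$ for all $\theta$ in the parameter space, with strict inequality for at least one such $\theta$; the dominance is strict if the inequality is strict for every $\theta$ in the parameter space. The minimum risk equivariant predictive density $\hat q_{\mathrm{mre}}(\cdot;X)$ (for Kullback-Leibler loss) is the $N(X_1,\sigma_1^2+\sigma_Y^2)$ density. $\hat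 q_{\pi_{U,A}}$ is the Bayes predictive density (minimizer of posterior expected Kullback-Leibler loss) for the uniform prior $\pi_{U,A}(\theta)=\mathbb{I}_A(\theta_1-\theta_2)$ on $\mathbb{R}^2$; it is the posterior predictive density $\hat q_{\pi_{U,A}}(y_1;x)=\int q_{\theta_1}(y_1)\,\pi(\theta\mid x)\,d\theta$. *)

theory Defs
  imports "HOL-Probability.Probability"
begin

text \<open>
  The known variances are given through the standard deviations \<open>s1, s2, sY > 0\<close>, following
  \<^const>\<open>normal_density\<close>, whose second argument is a standard deviation.
  A predictive density is a map \<open>q :: real \<times> real \<Rightarrow> real \<Rightarrow> real\<close>, where \<open>q x\<close> is
  the density on the real line chosen after observing \<open>X = x\<close>.
\<close>

definition param_space :: "real set \<Rightarrow> (real \<times> real) set" where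
  "param_space A = {\<theta>. fst \<theta> - snd \<theta> \<in> A}"

definition X_density :: "real \<Rightarrow> real \<Rightarrow> real \<times> real \<Rightarrow> real \<times> real \<Rightarrow> real" where
  "X_density s1 s2 \<theta> x = normal_density (fst \<theta>) s1 (fst x) * normal_density (snd \<theta>) s2 (snd x)"

definition X_law :: "real \<Rightarrow> real \<Rightarrow> real \<times> real \<Rightarrow> (real \<times> real) measure" where
  "X_law s1 s2 \<theta> = density lborel (\<lambda>x. ennreal (X_density s1 s2 \<theta> x))"

definition Y_density :: "real \<Rightarrow> real \<times> real \<Rightarrow> real \<Rightarrow> real" where
  "Y_density sY \<theta> y = normal_density (fst \<theta>) sY y"

text \<open>
  Losses and risks may be infinite for a general predictive density, and the Bochner integral would
  turn such values into 0. We therefore integrate with values in the extended reals, as the integral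
  of the positive part minus that of the negative part (\<^const>\<open>e2ennreal\<close> sends negative numbers
  to 0). For the Kullback-Leibler loss between two densities, the negative part always has
  integral at most 1, so that the difference is never of the form \<open>\<infinity> - \<infinity>\<close>.
\<close>

definition ext_integral :: "'a measure \<Rightarrow> ('a \<Rightarrow> ereal) \<Rightarrow> ereal" where
  "ext_integral M f =
     enn2ereal (\<integral>\<^sup>+ x. e2ennreal (f x) \<partial>M) - enn2ereal (\<integral>\<^sup>+ x. e2ennreal (- f x) \<partial>M)"

text \<open>
  The integrand \<open>q log (q / r)\<close>, with the usual conventions \<open>0 log (0 / r) = 0\<close> and
  \<open>q log (q / 0) = \<infinity>\<close> for \<open>q > 0\<close>.
\<close>

definition KL_integrand :: "real \<Rightarrow> real \<Rightarrow> ereal" where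
  "KL_integrand q r =
     (if q = 0 then 0 else if r = 0 then \<infinity> else ereal (q * ln (q / r)))"

definition KL_loss :: "real \<Rightarrow> real \<times> real \<Rightarrow> (real \<Rightarrow> real) \<Rightarrow> ereal" where
  "KL_loss sY \<theta> r = ext_integral lborel (\<lambda>y. KL_integrand (Y_density sY \<theta> y) (r y))"

definition KL_risk ::
  "real \<Rightarrow> real \<Rightarrow> real \<Rightarrow> real \<times> real \<Rightarrow> (real \<times> real \<Rightarrow> real \<Rightarrow> real) \<Rightarrow> ereal" where
  "KL_risk s1 s2 sY \<theta> q = ext_integral (X_law s1 s2 \<theta>) (\<lambda>x. KL_loss sY \<theta> (q x))"

definition dominates ::
  "real \<Rightarrow> real \<Rightarrow> real \<Rightarrow> real set \<Rightarrow>
   (real \<times> real \<Rightarrow> real \<Rightarrow> real) \<Rightarrow> (real \<times> real \<Rightarrow> real \<Rightarrow> real) \<Rightarrow> bool" where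
  "dominates s1 s2 sY A qa qb \<longleftrightarrow>
     (\<forall>\<theta>\<in>param_space A. KL_risk s1 s2 sY \<theta> qa \<le> KL_risk s1 s2 sY \<theta> qb) \<and>
     (\<exists>\<theta>\<in>param_space A. KL_risk s1 s2 sY \<theta> qa < KL_risk s1 s2 sY \<theta> qb)"

definition strictly_dominates ::
  "real \<Rightarrow> real \<Rightarrow> real \<Rightarrow> real set \<Rightarrow>
   (real \<times> real \<Rightarrow> real \<Rightarrow> real) \<Rightarrow> (real \<times> real \<Rightarrow> real \<Rightarrow> real) \<Rightarrow> bool" where
  "strictly_dominates s1 s2 sY A qa qb \<longleftrightarrow>
     dominates s1 s2 sY A qa qb \<and>
     (\<forall>\<theta>\<in>param_space A. KL_risk s1 s2 sY \<theta> qa < KL_risk s1 s2 sY \<theta> qb)"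

definition q_mre :: "real \<Rightarrow> real \<Rightarrow> real \<times> real \<Rightarrow> real \<Rightarrow> real" where
  "q_mre s1 sY x y = normal_density (fst x) (sqrt (s1\<^sup>2 + sY\<^sup>2)) y"

definition uniform_prior :: "real set \<Rightarrow> real \<times> real \<Rightarrow> real" where
  "uniform_prior A \<theta> = indicator A (fst \<theta> - snd \<theta>)"

definition posterior_density ::
  "real \<Rightarrow> real \<Rightarrow> (real \<times> real \<Rightarrow> real) \<Rightarrow> real \<times> real \<Rightarrow> real \<times> real \<Rightarrow> real" where
  "posterior_density s1 s2 prior x \<theta> =
     prior \<theta> * X_density s1 s2 \<theta> x / (\<integral>t. prior t * X_density s1 s2 t x \<partial>lborel)"

text \<open>
  The Bayes predictive density under Kullback-Leibler loss is the posterior predictive density.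
\<close>

definition q_Bayes ::
  "real \<Rightarrow> real \<Rightarrow> real \<Rightarrow> (real \<times> real \<Rightarrow> real) \<Rightarrow> real \<times> real \<Rightarrow> real \<Rightarrow> real" where
  "q_Bayes s1 s2 sY prior x y =
     (\<integral>\<theta>. Y_density sY \<theta> y * posterior_density s1 s2 prior x \<theta> \<partial>lborel)"

end

theory Submission imports Defs begin

text \<open>
  Let \<open>H\<^sub>\<sigma>(u)\<close> be the probability that an \<open>N(u, \<sigma>\<^sup>2)\<close> variable falls into \<open>[-m, m]\<close>.
  Bayes' rule turns the posterior predictive density into a correction of the minimum risk
  equivariant one (lemma \<open>q_Bayes_eq\<close>):
  \<open>q_Bayes x y = q_mre x y * H\<^sub>\<sigma>(W) / H\<^sub>\<tau>(V)\<close>, where \<open>V = x\<^sub>1 - x\<^sub>2\<close> estimates \<open>\<theta>\<^sub>1 - \<theta>\<^sub>2\<close>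
  from the data \<open>x\<close> alone, with standard deviation \<open>\<tau>\<close>, and \<open>W\<close> estimates it after
  \<open>x\<^sub>1\<close> has been replaced by the precision-weighted average of \<open>x\<^sub>1\<close> and \<open>y\<close>, with standard
  deviation \<open>\<sigma> < \<tau>\<close>. Indeed \<open>H\<^sub>\<tau>(V)\<close> and \<open>H\<^sub>\<sigma>(W)\<close> are the posterior probabilities of
  \<open>|\<theta>\<^sub>1 - \<theta>\<^sub>2| \<le> m\<close> for a flat prior on the plane, before and after seeing \<open>y\<close>.

  Hence the risk of \<open>q_mre\<close> minus the risk of \<open>q_Bayes\<close> at \<open>\<theta>\<close> is
  \<open>E ln H\<^sub>\<sigma>(W) - E ln H\<^sub>\<tau>(V)\<close>, and under \<open>\<theta>\<close> both estimators are unbiased: with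
  \<open>\<delta> = \<theta>\<^sub>1 - \<theta>\<^sub>2\<close>, \<open>W\<close> has law \<open>N(\<delta>, \<sigma>\<^sup>2)\<close> and \<open>V\<close> has law \<open>N(\<delta>, \<tau>\<^sup>2)\<close>. Only the two marginal
  laws matter, so both may be realised with one standard normal \<open>Z\<close>, as \<open>\<delta> + \<sigma>Z\<close> and
  \<open>\<delta> + \<tau>Z\<close>. Now \<open>H\<^sub>s(\<delta> + sZ)\<close> is the standard normal mass of the interval from \<open>-(m + \<delta>)/s - Z\<close>
  to \<open>(m - \<delta>)/s - Z\<close>. When \<open>|\<delta>| \<le> m\<close>, both \<open>m + \<delta>\<close> and \<open>m - \<delta>\<close> are nonnegative, and
  they are not both zero; so these intervals grow strictly as \<open>s\<close> decreases, and
  \<open>H\<^sub>\<tau>(\<delta> + \<tau>Z) < H\<^sub>\<sigma>(\<delta> + \<sigma>Z)\<close> holds pointwise (lemma \<open>cover_less\<close>).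

  What remains is to know that all the risks are finite, so that they may be subtracted. Every
  logarithm that occurs is bounded by a quadratic function of the observations, and Gaussian laws have
  second moments.
\<close>

section \<open>Gaussian laws and their linear combinations\<close>

definition gaussian :: "real \<Rightarrow> real \<Rightarrow> real measure" where
  "gaussian \<mu> \<sigma> = density lborel (\<lambda>x. ennreal (normal_density \<mu> \<sigma> x))"

lemma sets_gaussian [simp, measurable_cong]: "sets (gaussian \<mu> \<sigma>) = sets borel"
  by (simp add: gaussian_def)

lemma space_gaussian [simp]: "space (gaussian \<mu> \<sigma>) = UNIV"
  by (simp add: gaussian_def)

lemma prob_space_gaussian: "0 < \<sigma> \<Longrightarrow> prob_space (gaussian \<mu> \<sigma>)"
  by (simp add: gaussian_def prob_space_normal_density)

lemma gaussian_lincomb: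
  fixes \<mu> \<nu> \<sigma> \<tau> a b :: real
  assumes "0 < \<sigma>" "0 < \<tau>" "a \<noteq> 0" "b \<noteq> 0"
  shows "distr (gaussian \<mu> \<sigma> \<Otimes>\<^sub>M gaussian \<nu> \<tau>) borel (\<lambda>z. a * fst z + b * snd z)
    = gaussian (a * \<mu> + b * \<nu>) (sqrt (a\<^sup>2 * \<sigma>\<^sup>2 + b\<^sup>2 * \<tau>\<^sup>2))"
proof -
  interpret M: prob_space "gaussian \<mu> \<sigma>" by (rule prob_space_gaussian) fact
  interpret N: prob_space "gaussian \<nu> \<tau>" by (rule prob_space_gaussian) fact
  interpret P: pair_prob_space "gaussian \<mu> \<sigma>" "gaussian \<nu> \<tau>" ..
  interpret Q: pair_prob_space "gaussian \<nu> \<tau>" "gaussian \<mu> \<sigma>" ..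
  let ?P = "gaussian \<mu> \<sigma> \<Otimes>\<^sub>M gaussian \<nu> \<tau>"
  have fst: "distr ?P borel fst = gaussian \<mu> \<sigma>"
    using N.distr_pair_fst[of "gaussian \<mu> \<sigma>"] by (simp cong: distr_cong)
  have snd: "distr ?P borel snd = gaussian \<nu> \<tau>"
  proof -
    have "distr ?P borel snd = distr (distr (gaussian \<nu> \<tau> \<Otimes>\<^sub>M gaussian \<mu> \<sigma>) ?P (\<lambda>(x, y). (y, x))) borel snd"
      by (subst P.distr_pair_swap) simp
    also have "\<dots> = distr (gaussian \<nu> \<tau> \<Otimes>\<^sub>M gaussian \<mu> \<sigma>) borel fst"
      by (subst distr_distr) (auto simp: comp_def split_beta)
    also have "\<dots> = gaussian \<nu> \<tau>"
      using M.distr_pair_fst[of "gaussian \<nu> \<tau>"] by (simp cong: distr_cong)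
    finally show ?thesis .
  qed
  have "P.indep_var borel fst borel snd"
    unfolding P.indep_var_distribution_eq by (auto simp: fst snd intro!: distr_id2[symmetric] sets_pair_measure_cong)
  then have "P.indep_var borel ((\<lambda>x. a * x) \<circ> fst) borel ((\<lambda>x. b * x) \<circ> snd)"
    by (rule P.indep_var_compose) auto
  then have indep: "P.indep_var borel (\<lambda>z. a * fst z) borel (\<lambda>z. b * snd z)"
    by (simp add: comp_def)
  have "distributed ?P lborel fst (normal_density \<mu> \<sigma>)"
    using fst by (auto simp: distributed_def gaussian_def[symmetric] cong: distr_cong)
  from P.normal_density_affine[OF this \<open>0 < \<sigma>\<close> \<open>a \<noteq> 0\<close>, of 0]
  have X: "distributed ?P lborel (\<lambda>z. a * fst z) (normal_density (a * \<mu>) (\<bar>a\<bar> * \<sigma>))"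
    by simp
  have "distributed ?P lborel snd (normal_density \<nu> \<tau>)"
    using snd by (auto simp: distributed_def gaussian_def[symmetric] cong: distr_cong)
  from P.normal_density_affine[OF this \<open>0 < \<tau>\<close> \<open>b \<noteq> 0\<close>, of 0]
  have Y: "distributed ?P lborel (\<lambda>z. b * snd z) (normal_density (b * \<nu>) (\<bar>b\<bar> * \<tau>))"
    by simp
  have "distributed ?P lborel (\<lambda>z. a * fst z + b * snd z)
    (normal_density (a * \<mu> + b * \<nu>) (sqrt ((\<bar>a\<bar> * \<sigma>)\<^sup>2 + (\<bar>b\<bar> * \<tau>)\<^sup>2)))"
    by (rule P.add_indep_normal[OF indep _ _ X Y]) (use assms in auto)
  then show ?thesis
    by (auto simp: distributed_def gaussian_def[symmetric] power_mult_distrib cong: distr_cong)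
qed

text \<open>
  The triple product is grouped as data and future observation; pushing the data pair to the
  single variable \<open>a x\<^sub>1 + b x\<^sub>2\<close> first reduces the claim to two summands.
\<close>
lemma gaussian_lincomb3:
  fixes \<mu> \<nu> \<xi> \<sigma> \<tau> \<rho> a b c :: real
  assumes "0 < \<sigma>" "0 < \<tau>" "0 < \<rho>" "a \<noteq> 0" "b \<noteq> 0" "c \<noteq> 0"
  shows "distr ((gaussian \<mu> \<sigma> \<Otimes>\<^sub>M gaussian \<nu> \<tau>) \<Otimes>\<^sub>M gaussian \<xi> \<rho>) borel
      (\<lambda>z. a * fst (fst z) + b * snd (fst z) + c * snd z)
    = gaussian (a * \<mu> + b * \<nu> + c * \<xi>) (sqrt (a\<^sup>2 * \<sigma>\<^sup>2 + b\<^sup>2 * \<tau>\<^sup>2 + c\<^sup>2 * \<rho>\<^sup>2))"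
proof -
  let ?M = "gaussian \<mu> \<sigma> \<Otimes>\<^sub>M gaussian \<nu> \<tau>" and ?N = "gaussian \<xi> \<rho>"
  let ?L = "\<lambda>z. a * fst z + b * snd z" and ?s = "sqrt (a\<^sup>2 * \<sigma>\<^sup>2 + b\<^sup>2 * \<tau>\<^sup>2)"
  have s: "0 < ?s" using assms by (intro real_sqrt_gt_zero add_pos_pos) auto
  have N: "sigma_finite_measure (distr ?N borel (\<lambda>y. y))"
    using prob_space_imp_sigma_finite[OF prob_space_gaussian[OF \<open>0 < \<rho>\<close>]]
    by (subst distr_id2) auto
  have "gaussian (a * \<mu> + b * \<nu>) ?s \<Otimes>\<^sub>M ?N = distr ?M borel ?L \<Otimes>\<^sub>M distr ?N borel (\<lambda>y. y)"
    using assms by (simp add: gaussian_lincomb distr_id2)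
  also have "\<dots> = distr (?M \<Otimes>\<^sub>M ?N) (borel \<Otimes>\<^sub>M borel) (\<lambda>(x, y). (?L x, y))"
    using N by (intro pair_measure_distr) auto
  finally have "distr (gaussian (a * \<mu> + b * \<nu>) ?s \<Otimes>\<^sub>M ?N) borel (\<lambda>z. 1 * fst z + c * snd z)
    = distr (?M \<Otimes>\<^sub>M ?N) borel ((\<lambda>z. 1 * fst z + c * snd z) \<circ> (\<lambda>(x, y). (?L x, y)))"
    by (simp only:) (subst distr_distr; auto)
  also have "(\<lambda>z. 1 * fst z + c * snd z) \<circ> (\<lambda>(x, y). (?L x, y)) = (\<lambda>z. a * fst (fst z) + b * snd (fst z) + c * snd z)"
    by (auto simp: fun_eq_iff)
  finally show ?thesis
    using gaussian_lincomb[OF s \<open>0 < \<rho>\<close>, of 1 c "a * \<mu> + b * \<nu>" \<xi>] assms by simp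
qed

text \<open>
  This realises all normal laws with the same mean on one probability space, which is
  what the pointwise comparison of two standard deviations requires.
\<close>
lemma gaussian_affine:
  assumes "0 < \<sigma>"
  shows "gaussian \<mu> \<sigma> = distr (gaussian 0 1) borel (\<lambda>z. \<mu> + \<sigma> * z)"
proof -
  interpret prob_space "gaussian 0 1" by (rule prob_space_gaussian) simp
  have "distributed (gaussian 0 1) lborel (\<lambda>x. x) (normal_density 0 1)"
    by (auto simp: distributed_def gaussian_def intro!: distr_id2)
  from normal_density_affine[OF this, of \<sigma> \<mu>] assms show ?thesis
    by (auto simp: distributed_def gaussian_def[symmetric] cong: distr_cong)
qed

text \<open>
  The larger interval contains a nonempty open interval outside the smaller one, and that has
  positive mass because the density vanishes nowhere.
\<close>
lemma gaussian_interval_less: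
  fixes a b a' b' :: real
  assumes "0 < \<sigma>" "a' \<le> a" "a \<le> b" "b \<le> b'" "a' < a \<or> b < b'"
  shows "measure (gaussian \<mu> \<sigma>) {a..b} < measure (gaussian \<mu> \<sigma>) {a'..b'}"
proof -
  interpret prob_space "gaussian \<mu> \<sigma>" by (rule prob_space_gaussian) fact
  have nz: "ennreal (normal_density \<mu> \<sigma> x) \<noteq> 0" for x
    using normal_density_pos[OF \<open>0 < \<sigma>\<close>, of \<mu> x] by (simp add: ennreal_eq_0_iff not_le)
  have pos: "0 < measure (gaussian \<mu> \<sigma>) {c<..<d}" if "c < d" for c d
  proof (rule ccontr)
    assume "\<not> 0 < measure (gaussian \<mu> \<sigma>) {c<..<d}"
    then have "emeasure (gaussian \<mu> \<sigma>) {c<..<d} = 0"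
      by (simp add: emeasure_eq_measure not_less measure_le_0_iff)
    then have "{c<..<d} \<in> null_sets (density lborel (\<lambda>x. ennreal (normal_density \<mu> \<sigma> x)))"
      by (auto simp: null_sets_def gaussian_def)
    then have "AE x in lborel. x \<in> {c<..<d} \<longrightarrow> ennreal (normal_density \<mu> \<sigma> x) = 0"
      by (subst (asm) null_sets_density_iff) auto
    then have "AE x in lborel. x \<notin> {c<..<d}"
      by eventually_elim (simp add: nz)
    then have "{c<..<d} \<in> null_sets lborel"
      by (subst AE_iff_null_sets) auto
    then show False using that by (simp add: null_sets_def)
  qed
  obtain c d where cd: "c < d" "{c<..<d} \<subseteq> {a'..b'} - {a..b}"
  proof (cases "a' < a")
    case True
    then show ?thesis using assms by (intro that[of a' a]) auto
  next
    case False
    then show ?thesis using assms by (intro that[of b b']) auto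
  qed
  have "0 < measure (gaussian \<mu> \<sigma>) {c<..<d}" by (rule pos) fact
  also have "\<dots> \<le> measure (gaussian \<mu> \<sigma>) ({a'..b'} - {a..b})"
    using cd by (intro finite_measure_mono) auto
  also have "\<dots> = measure (gaussian \<mu> \<sigma>) {a'..b'} - measure (gaussian \<mu> \<sigma>) {a..b}"
    using assms by (intro finite_measure_Diff) auto
  finally show ?thesis by simp
qed

section \<open>The posterior predictive density as a corrected equivariant density\<close>
lemma X_law_eq:
  assumes "0 < s1" "0 < s2"
  shows "X_law s1 s2 \<theta> = gaussian (fst \<theta>) s1 \<Otimes>\<^sub>M gaussian (snd \<theta>) s2"
  unfolding gaussian_def
proof (subst pair_measure_density)
  show "sigma_finite_measure (density lborel (\<lambda>x. ennreal (normal_density (snd \<theta>) s2 x)))"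
    using prob_space_normal_density[OF \<open>0 < s2\<close>] prob_space_imp_sigma_finite by blast
qed (auto simp: X_law_def X_density_def lborel_prod case_prod_beta' ennreal_mult' intro!: sigma_finite_lborel)

text \<open>
  Under the normal law that \<open>X_density \<sigma> \<tau> \<mu>\<close> describes, the difference of the coordinates is normal
  again, and the prior depends on that difference only. Read as a
  function of the parameter, the likelihood is such a density, so this evaluates both the
  normalising constant of the posterior and, after completing the square, the predictive integral.
\<close>
lemma integral_uniform_prior:
  assumes "0 < \<sigma>" "0 < \<tau>" and [measurable]: "A \<in> sets borel"
  shows "(\<integral>t. uniform_prior A t * X_density \<sigma> \<tau> \<mu> t \<partial>lborel)
    = measure (gaussian (fst \<mu> - snd \<mu>) (sqrt (\<sigma>\<^sup>2 + \<tau>\<^sup>2))) A"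
proof -
  have [measurable]: "uniform_prior A \<in> borel_measurable borel" "X_density \<sigma> \<tau> \<mu> \<in> borel_measurable borel"
    unfolding uniform_prior_def[abs_def] X_density_def[abs_def] borel_prod[symmetric] by measurable
  have "(\<integral>t. uniform_prior A t * X_density \<sigma> \<tau> \<mu> t \<partial>lborel) = (\<integral>t. uniform_prior A t \<partial>X_law \<sigma> \<tau> \<mu>)"
    unfolding X_law_def by (subst integral_density) (auto simp: X_density_def mult.commute)
  also have "\<dots> = (\<integral>t. indicator A (1 * fst t + (-1) * snd t) \<partial>(gaussian (fst \<mu>) \<sigma> \<Otimes>\<^sub>M gaussian (snd \<mu>) \<tau>))"
    using assms by (simp add: X_law_eq uniform_prior_def)
  also have "\<dots> = (\<integral>u. indicator A u \<partial>distr (gaussian (fst \<mu>) \<sigma> \<Otimes>\<^sub>M gaussian (snd \<mu>) \<tau>) borel (\<lambda>t. 1 * fst t + (-1) * snd t))"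
    by (subst integral_distr) auto
  also have "\<dots> = measure (gaussian (fst \<mu> - snd \<mu>) (sqrt (\<sigma>\<^sup>2 + \<tau>\<^sup>2))) A"
    using assms by (subst gaussian_lincomb) auto
  finally show ?thesis .
qed

text \<open>
  The best estimator of the common mean of two independent normal observations with standard
  deviations \<open>s1\<close> and \<open>sY\<close>; each observation is weighted by its precision, here written as the
  variance of the other one over the sum of the variances.
\<close>
definition pooled :: "real \<Rightarrow> real \<Rightarrow> real \<Rightarrow> real \<Rightarrow> real" where
  "pooled s1 sY x y = (sY\<^sup>2 / (s1\<^sup>2 + sY\<^sup>2)) * x + (s1\<^sup>2 / (s1\<^sup>2 + sY\<^sup>2)) * y"

definition pooled_sd :: "real \<Rightarrow> real \<Rightarrow> real" where
  "pooled_sd s1 sY = s1 * sY / sqrt (s1\<^sup>2 + sY\<^sup>2)"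

text \<open>
  Completing the square in the common mean \<open>t\<close>: the first factor is the density of the second
  observation given the first for a flat prior on \<open>t\<close>, the second one the posterior of \<open>t\<close>
  given both.
\<close>
lemma normal_density_pooling:
  assumes "0 < s1" "0 < sY"
  shows "normal_density t sY y * normal_density t s1 x
    = normal_density x (sqrt (s1\<^sup>2 + sY\<^sup>2)) y * normal_density (pooled s1 sY x y) (pooled_sd s1 sY) t"
proof -
  \<comment> \<open>The identity is checked separately for the normalising constants and for the exponents, as rational identities in the variances.\<close>
  define v w where "v = s1\<^sup>2" and "w = sY\<^sup>2"
  have vw: "0 < v" "0 < w" using assms by (auto simp: v_def w_def)
  have sd: "(pooled_sd s1 sY)\<^sup>2 = v * w / (v + w)"
    using vw by (simp add: pooled_sd_def v_def w_def power_divide power_mult_distrib)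
  have c: "1 / sqrt (2 * pi * w) * (1 / sqrt (2 * pi * v))
    = 1 / sqrt (2 * pi * (v + w)) * (1 / sqrt (2 * pi * (v * w / (v + w))))"
    using vw by (simp add: real_sqrt_mult[symmetric])
  have e: "- (y - t)\<^sup>2 / (2 * w) + - (x - t)\<^sup>2 / (2 * v) = - (y - x)\<^sup>2 / (2 * (v + w))
    + - (t - pooled s1 sY x y)\<^sup>2 / (2 * (v * w / (v + w)))"
  proof -
    have p: "t - pooled s1 sY x y = ((v + w) * t - w * x - v * y) / (v + w)"
    proof -
      have "pooled s1 sY x y = (w * x + v * y) / (v + w)"
        by (simp add: pooled_def v_def w_def add_divide_distrib)
      then show ?thesis using vw by (simp add: divide_simps) (simp add: algebra_simps)
    qed
    have nz: "v \<noteq> 0" "w \<noteq> 0" "v + w \<noteq> 0" using vw by auto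
    show ?thesis unfolding p using nz
      by (simp add: power_divide divide_simps) (simp add: power2_eq_square algebra_simps)
  qed
  have "normal_density t sY y * normal_density t s1 x =
    (1 / sqrt (2 * pi * w) * (1 / sqrt (2 * pi * v))) * exp (- (y - t)\<^sup>2 / (2 * w) + - (x - t)\<^sup>2 / (2 * v))"
    by (simp add: normal_density_def v_def w_def mult_exp_exp)
  also have "\<dots> = normal_density x (sqrt (s1\<^sup>2 + sY\<^sup>2)) y * normal_density (pooled s1 sY x y) (pooled_sd s1 sY) t"
    unfolding c e exp_add using vw by (simp add: normal_density_def sd v_def[symmetric] w_def[symmetric])
  finally show ?thesis .
qed

text \<open>The function \<open>H\<^sub>\<sigma>(u)\<close> of the introduction.\<close>
definition cover :: "real \<Rightarrow> real \<Rightarrow> real \<Rightarrow> real" where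
  "cover m \<sigma> u = measure (gaussian u \<sigma>) {-m..m}"

text \<open>
  By pooling \<open>y\<close> with \<open>x\<^sub>1\<close>, the numerator of Bayes' rule has the same form as the normalising constant,
  with \<open>x\<^sub>1\<close> replaced by the pooled observation, and the factor \<open>q_mre x y\<close> comes out.
\<close>
lemma q_Bayes_eq:
  assumes "0 < s1" "0 < s2" "0 < sY"
  shows "q_Bayes s1 s2 sY (uniform_prior {-m..m}) x y = q_mre s1 sY x y *
    (cover m (sqrt ((pooled_sd s1 sY)\<^sup>2 + s2\<^sup>2)) (pooled s1 sY (fst x) y - snd x)
     / cover m (sqrt (s1\<^sup>2 + s2\<^sup>2)) (fst x - snd x))"
proof -
  have sd: "0 < pooled_sd s1 sY" using assms by (auto simp: pooled_sd_def intro!: divide_pos_pos real_sqrt_gt_zero add_pos_pos)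
  \<comment> \<open>The normal density is symmetric in argument and mean, so the likelihood is itself a normal density in the parameter, centred at the data.\<close>
  have sym: "X_density s1 s2 \<theta> x = X_density s1 s2 x \<theta>" for \<theta>
    by (simp add: X_density_def normal_density_def power2_commute)
  have Z: "(\<integral>t. uniform_prior {-m..m} t * X_density s1 s2 t x \<partial>lborel) = cover m (sqrt (s1\<^sup>2 + s2\<^sup>2)) (fst x - snd x)"
    unfolding sym cover_def using assms by (intro integral_uniform_prior) auto
  have split: "Y_density sY \<theta> y * (uniform_prior {-m..m} \<theta> * X_density s1 s2 \<theta> x / Z) =
    q_mre s1 sY x y / Z * (uniform_prior {-m..m} \<theta> *
       X_density (pooled_sd s1 sY) s2 (pooled s1 sY (fst x) y, snd x) \<theta>)" for \<theta> Z
  proof -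
    have "Y_density sY \<theta> y * X_density s1 s2 \<theta> x
      = (normal_density (fst \<theta>) sY y * normal_density (fst \<theta>) s1 (fst x)) * normal_density (snd \<theta>) s2 (snd x)"
      by (simp add: Y_density_def X_density_def)
    also have "normal_density (snd \<theta>) s2 (snd x) = normal_density (snd x) s2 (snd \<theta>)"
      by (simp add: normal_density_def power2_commute)
    finally have "Y_density sY \<theta> y * X_density s1 s2 \<theta> x
      = q_mre s1 sY x y * X_density (pooled_sd s1 sY) s2 (pooled s1 sY (fst x) y, snd x) \<theta>"
      by (simp add: normal_density_pooling[OF assms(1,3)] X_density_def q_mre_def)
    then show ?thesis
      by (metis (no_types, lifting) mult.left_commute times_divide_eq_left times_divide_eq_right)
  qed
  show ?thesis
    unfolding q_Bayes_def posterior_density_def Z split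
    using integral_uniform_prior[OF sd assms(2), of "{-m..m}" "(pooled s1 sY (fst x) y, snd x)"]
    by (simp add: cover_def)
qed

section \<open>Finiteness of the risks\<close>

text \<open>
  For measurable functions this is the integrability criterion behind every risk below. Stated with the
  norm, it is stable under differences, under composition with linear maps and under fixing a
  coordinate, so it only has to be checked for functions of one real variable.
\<close>
definition quadratic_growth :: "('a::real_normed_vector \<Rightarrow> real) \<Rightarrow> bool" where
  "quadratic_growth f \<longleftrightarrow> (\<exists>C. \<forall>z. \<bar>f z\<bar> \<le> C * (1 + (norm z)\<^sup>2))"

lemma quadratic_growthI:
  fixes f :: "'a::real_normed_vector \<Rightarrow> real"
  assumes "\<And>z. \<bar>f z\<bar> \<le> A + B * (norm z)\<^sup>2"
  shows "quadratic_growth f"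
  unfolding quadratic_growth_def
proof (intro exI allI)
  fix z :: 'a
  have "A \<le> max A B" "B * (norm z)\<^sup>2 \<le> max A B * (norm z)\<^sup>2" by (auto intro: mult_right_mono)
  with assms[of z] show "\<bar>f z\<bar> \<le> max A B * (1 + (norm z)\<^sup>2)"
    unfolding distrib_left by linarith
qed

lemma quadratic_growthE:
  fixes f :: "'a::real_normed_vector \<Rightarrow> real"
  assumes "quadratic_growth f"
  obtains C where "0 \<le> C" "\<And>z. \<bar>f z\<bar> \<le> C * (1 + (norm z)\<^sup>2)"
proof -
  from assms obtain C where C: "\<And>z. \<bar>f z\<bar> \<le> C * (1 + (norm z)\<^sup>2)"
    unfolding quadratic_growth_def by blast
  have "0 \<le> C" using order_trans[OF abs_ge_zero C[of 0]] by simp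
  with C that show ?thesis by blast
qed

lemma quadratic_growth_diff:
  assumes "quadratic_growth f" "quadratic_growth g"
  shows "quadratic_growth (\<lambda>z. f z - g z)"
proof -
  obtain C D where C: "\<And>z. \<bar>f z\<bar> \<le> C * (1 + (norm z)\<^sup>2)" and D: "\<And>z. \<bar>g z\<bar> \<le> D * (1 + (norm z)\<^sup>2)"
    using assms by (meson quadratic_growthE)
  have "\<bar>f z - g z\<bar> \<le> (C + D) * (1 + (norm z)\<^sup>2)" for z
    using C[of z] D[of z] by (simp add: distrib_right)
  then show ?thesis unfolding quadratic_growth_def by blast
qed

lemma quadratic_growth_linear:
  assumes "quadratic_growth f" "bounded_linear L"
  shows "quadratic_growth (\<lambda>z. f (L z))"
proof -
  obtain C where C: "0 \<le> C" "\<And>z. \<bar>f z\<bar> \<le> C * (1 + (norm z)\<^sup>2)"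
    using quadratic_growthE[OF assms(1)] by blast
  obtain K where K: "\<And>z. norm (L z) \<le> norm z * K"
    using bounded_linear.bounded[OF assms(2)] by blast
  have "\<bar>f (L z)\<bar> \<le> C + C * K\<^sup>2 * (norm z)\<^sup>2" for z
  proof -
    have "(norm (L z))\<^sup>2 \<le> (norm z * K)\<^sup>2" by (intro power_mono K) simp
    then have "C * (1 + (norm (L z))\<^sup>2) \<le> C * (1 + (norm z * K)\<^sup>2)" using C(1) by (intro mult_left_mono) auto
    with C(2)[of "L z"] show ?thesis by (simp add: algebra_simps power_mult_distrib)
  qed
  then show ?thesis by (rule quadratic_growthI)
qed

lemma quadratic_growth_section:
  assumes "quadratic_growth (F :: 'a::real_normed_vector \<times> 'b::real_normed_vector \<Rightarrow> real)"
  shows "quadratic_growth (\<lambda>y. F (x, y))"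
proof -
  obtain C where C: "\<And>z. \<bar>F z\<bar> \<le> C * (1 + (norm z)\<^sup>2)"
    using quadratic_growthE[OF assms] by blast
  have "\<bar>F (x, y)\<bar> \<le> C * (1 + (norm x)\<^sup>2) + C * (norm y)\<^sup>2" for y
    using C[of "(x, y)"] by (simp add: norm_Pair algebra_simps)
  then show ?thesis by (rule quadratic_growthI)
qed

lemma quadratic_growth_ln_normal_density:
  assumes "0 < \<sigma>"
  shows "quadratic_growth (\<lambda>x. ln (normal_density \<mu> \<sigma> x))"
proof (rule quadratic_growthI)
  fix x :: real
  let ?K = "ln (1 / sqrt (2 * pi * \<sigma>\<^sup>2))"
  have "ln (normal_density \<mu> \<sigma> x) = ?K - (x - \<mu>)\<^sup>2 / (2 * \<sigma>\<^sup>2)"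
    using assms unfolding normal_density_def by (subst ln_mult) auto
  moreover have "(x - \<mu>)\<^sup>2 / (2 * \<sigma>\<^sup>2) \<le> \<mu>\<^sup>2 / \<sigma>\<^sup>2 + 1 / \<sigma>\<^sup>2 * (norm x)\<^sup>2"
  proof -
    have "0 \<le> (x + \<mu>)\<^sup>2" by simp
    then have "(x - \<mu>)\<^sup>2 \<le> 2 * (\<mu>\<^sup>2 + x\<^sup>2)" by (simp add: power2_sum power2_diff)
    then show ?thesis using assms by (simp add: field_simps)
  qed
  moreover have "0 \<le> (x - \<mu>)\<^sup>2 / (2 * \<sigma>\<^sup>2)" by simp
  ultimately show "\<bar>ln (normal_density \<mu> \<sigma> x)\<bar> \<le> (\<bar>?K\<bar> + \<mu>\<^sup>2 / \<sigma>\<^sup>2) + 1 / \<sigma>\<^sup>2 * (norm x)\<^sup>2"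
    by linarith
qed

lemma integrable_quadratic_growth:
  assumes "prob_space M" and sets: "sets M = sets borel" and sq: "integrable M (\<lambda>z. (norm z)\<^sup>2)"
    and "f \<in> borel_measurable borel" "quadratic_growth f"
  shows "integrable M f"
proof -
  interpret prob_space M by fact
  obtain C where C: "\<And>z. \<bar>f z\<bar> \<le> C * (1 + (norm z)\<^sup>2)"
    using assms by (meson quadratic_growthE)
  have "integrable M (\<lambda>z. C * (1 + (norm z)\<^sup>2))" using sq by auto
  moreover have "f \<in> borel_measurable M" using assms measurable_cong_sets[OF sets refl] by blast
  ultimately show ?thesis
    by (rule Bochner_Integration.integrable_bound) (auto intro!: AE_I2 order_trans[OF C])
qed

lemma integrable_gaussian_square:
  assumes "0 < \<sigma>"
  shows "integrable (gaussian \<mu> \<sigma>) (\<lambda>x. (norm x)\<^sup>2)"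
proof -
  have "integrable lborel (\<lambda>x. normal_density \<mu> \<sigma> x * (x - \<mu>)^2 + 2 * \<mu> * (normal_density \<mu> \<sigma> x * (x - \<mu>)^1)
      + \<mu>\<^sup>2 * (normal_density \<mu> \<sigma> x * (x - \<mu>)^0))"
    by (intro Bochner_Integration.integrable_add integrable_mult_right integrable_normal_moment assms)
  also have "(\<lambda>x. normal_density \<mu> \<sigma> x * (x - \<mu>)^2 + 2 * \<mu> * (normal_density \<mu> \<sigma> x * (x - \<mu>)^1)
      + \<mu>\<^sup>2 * (normal_density \<mu> \<sigma> x * (x - \<mu>)^0)) = (\<lambda>x. normal_density \<mu> \<sigma> x * (norm x)\<^sup>2)"
    by (simp add: fun_eq_iff power2_eq_square algebra_simps)
  finally show ?thesis
    unfolding gaussian_def by (subst integrable_real_density) auto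
qed

lemma integrable_gaussian_quadratic_growth:
  assumes "0 < \<sigma>" "f \<in> borel_measurable borel" "quadratic_growth f"
  shows "integrable (gaussian \<mu> \<sigma>) f"
  by (rule integrable_quadratic_growth[OF prob_space_gaussian sets_gaussian integrable_gaussian_square]) fact+

text \<open>The squared norm of a pair is the sum of the squared norms, each depending on one coordinate only.\<close>
lemma integrable_pair_square:
  fixes M :: "'a::euclidean_space measure" and N :: "'b::euclidean_space measure"
  assumes "prob_space M" "prob_space N" and [measurable_cong]: "sets M = sets borel" "sets N = sets borel"
    and M: "integrable M (\<lambda>x. (norm x)\<^sup>2)" and N: "integrable N (\<lambda>y. (norm y)\<^sup>2)"
  shows "integrable (M \<Otimes>\<^sub>M N) (\<lambda>z. (norm z)\<^sup>2)"
proof -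
  interpret M: prob_space M by fact
  interpret N: prob_space N by fact
  interpret P: pair_prob_space M N ..
  have "integrable (M \<Otimes>\<^sub>M N) (\<lambda>z. (norm (fst z))\<^sup>2)"
    using M by (intro P.Fubini_integrable) auto
  moreover have "integrable (M \<Otimes>\<^sub>M N) (\<lambda>z. (norm (snd z))\<^sup>2)"
    using N by (intro P.Fubini_integrable) auto
  ultimately show ?thesis
    by (subst norm_prod_def) auto
qed

lemma ext_integral_ereal:
  assumes "integrable M f"
  shows "ext_integral M (\<lambda>x. ereal (f x)) = ereal (integral\<^sup>L M f)"
proof -
  from assms obtain r q where "0 \<le> r" "0 \<le> q" "(\<integral>\<^sup>+x. ennreal (f x) \<partial>M) = ennreal r"
    "(\<integral>\<^sup>+x. ennreal (- f x) \<partial>M) = ennreal q" "integral\<^sup>L M f = r - q"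
    by (rule integrableE)
  then show ?thesis by (simp add: ext_integral_def enn2ereal_ennreal)
qed

text \<open>
  Both densities are positive and the log-likelihood ratio is integrable, so the extended-valued loss
  is an ordinary expectation under the true density.
\<close>
lemma KL_loss_eq:
  assumes "0 < sY" and pos: "\<And>y. 0 < r y" and meas: "(\<lambda>y. ln (Y_density sY \<theta> y / r y)) \<in> borel_measurable borel"
    and int: "integrable (gaussian (fst \<theta>) sY) (\<lambda>y. ln (Y_density sY \<theta> y / r y))"
  shows "KL_loss sY \<theta> r = ereal (\<integral>y. ln (Y_density sY \<theta> y / r y) \<partial>gaussian (fst \<theta>) sY)"
proof -
  let ?l = "\<lambda>y. ln (Y_density sY \<theta> y / r y)"
  have nz: "Y_density sY \<theta> y \<noteq> 0" "r y \<noteq> 0" for y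
    using normal_density_pos[OF \<open>0 < sY\<close>] pos[of y] by (auto simp: Y_density_def less_le)
  have "integrable lborel (\<lambda>y. Y_density sY \<theta> y * ?l y)"
    using int meas unfolding gaussian_def Y_density_def by (subst (asm) integrable_real_density) auto
  then have "KL_loss sY \<theta> r = ereal (\<integral>y. Y_density sY \<theta> y * ?l y \<partial>lborel)"
    unfolding KL_loss_def KL_integrand_def using nz by (simp add: ext_integral_ereal)
  also have "(\<integral>y. Y_density sY \<theta> y * ?l y \<partial>lborel) = (\<integral>y. ?l y \<partial>gaussian (fst \<theta>) sY)"
    using meas unfolding gaussian_def Y_density_def by (subst integral_density) auto
  finally show ?thesis .
qed

text \<open>The joint law of the data \<open>X\<close> and the future observation \<open>Y\<^sub>1\<close>.\<close>
definition XY_law :: "real \<Rightarrow> real \<Rightarrow> real \<Rightarrow> real \<times> real \<Rightarrow> ((real \<times> real) \<times> real) measure" where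
  "XY_law s1 s2 sY \<theta> = (gaussian (fst \<theta>) s1 \<Otimes>\<^sub>M gaussian (snd \<theta>) s2) \<Otimes>\<^sub>M gaussian (fst \<theta>) sY"

lemma sets_XY_law [simp, measurable_cong]: "sets (XY_law s1 s2 sY \<theta>) = sets borel"
  unfolding XY_law_def borel_prod[symmetric] by (intro sets_pair_measure_cong) auto

lemma integrable_XY_law:
  assumes "0 < s1" "0 < s2" "0 < sY" "F \<in> borel_measurable borel" "quadratic_growth F"
  shows "integrable (XY_law s1 s2 sY \<theta>) F"
proof (rule integrable_quadratic_growth[OF _ sets_XY_law _ assms(4,5)])
  have G: "prob_space (gaussian (fst \<theta>) s1 \<Otimes>\<^sub>M gaussian (snd \<theta>) s2)"
    using assms by (intro prob_space_pair prob_space_gaussian)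
  have S: "sets (gaussian (fst \<theta>) s1 \<Otimes>\<^sub>M gaussian (snd \<theta>) s2) = sets borel"
    unfolding borel_prod[symmetric] by (intro sets_pair_measure_cong) auto
  show "prob_space (XY_law s1 s2 sY \<theta>)"
    unfolding XY_law_def using assms by (intro prob_space_pair prob_space_gaussian G)
  show "integrable (XY_law s1 s2 sY \<theta>) (\<lambda>z. (norm z)\<^sup>2)"
    unfolding XY_law_def using assms
    by (intro integrable_pair_square prob_space_gaussian G S integrable_gaussian_square sets_gaussian)
qed

text \<open>
  Averaging the loss over the data is Fubini's theorem on the joint law of \<open>X\<close> and \<open>Y\<^sub>1\<close>. Quadratic
  growth makes the loss finite for every \<open>x\<close>, not just almost every one, so
  that the equation for the loss may be substituted under the integral.
\<close>
lemma KL_risk_eq: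
  assumes s: "0 < s1" "0 < s2" "0 < sY" and pos: "\<And>x y. 0 < q x y"
    and meas: "(\<lambda>z. ln (Y_density sY \<theta> (snd z) / q (fst z) (snd z))) \<in> borel_measurable borel"
    and growth: "quadratic_growth (\<lambda>z. ln (Y_density sY \<theta> (snd z) / q (fst z) (snd z)))"
  shows "KL_risk s1 s2 sY \<theta> q = ereal (\<integral>z. ln (Y_density sY \<theta> (snd z) / q (fst z) (snd z)) \<partial>XY_law s1 s2 sY \<theta>)"
proof -
  let ?F = "\<lambda>z. ln (Y_density sY \<theta> (snd z) / q (fst z) (snd z))"
  let ?M = "gaussian (fst \<theta>) s1 \<Otimes>\<^sub>M gaussian (snd \<theta>) s2" and ?N = "gaussian (fst \<theta>) sY"
  interpret M: prob_space ?M using s by (intro prob_space_pair prob_space_gaussian)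
  interpret N: prob_space ?N using s by (intro prob_space_gaussian)
  interpret P: pair_prob_space ?M ?N ..
  have sec: "(\<lambda>y. ?F (x, y)) \<in> borel_measurable borel" for x
  proof -
    have "(\<lambda>y. (x, y)) \<in> borel_measurable borel"
      by (rule borel_measurable_continuous_onI) (rule continuous_on_Pair[OF continuous_on_const continuous_on_id])
    from measurable_compose[OF this meas] show ?thesis .
  qed
  have loss: "KL_loss sY \<theta> (q x) = ereal (\<integral>y. ?F (x, y) \<partial>?N)" for x
  proof -
    have "integrable ?N (\<lambda>y. ?F (x, y))"
      by (rule integrable_gaussian_quadratic_growth[OF s(3) sec quadratic_growth_section[OF growth]])
    with sec[of x] show ?thesis
      unfolding fst_conv snd_conv by (intro KL_loss_eq s(3) pos)
  qed
  have int: "integrable (?M \<Otimes>\<^sub>M ?N) ?F"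
    using integrable_XY_law[OF s meas growth, of \<theta>] by (simp add: XY_law_def)
  have "KL_risk s1 s2 sY \<theta> q = ereal (\<integral>x. (\<integral>y. ?F (x, y) \<partial>?N) \<partial>?M)"
    unfolding KL_risk_def loss X_law_eq[OF s(1,2)] by (intro ext_integral_ereal P.integrable_fst' int)
  also have "(\<integral>x. (\<integral>y. ?F (x, y) \<partial>?N) \<partial>?M) = (\<integral>z. ?F z \<partial>(?M \<Otimes>\<^sub>M ?N))"
    by (intro P.integral_fst' int)
  finally show ?thesis by (simp add: XY_law_def)
qed

section \<open>Comparing coverage probabilities at two standard deviations\<close>
lemma cover_eq_integral:
  "cover m \<sigma> u = (\<integral>t. indicator {-m..m} t * normal_density u \<sigma> t \<partial>lborel)"
proof -
  have "cover m \<sigma> u = (\<integral>t. indicator {-m..m} t \<partial>gaussian u \<sigma>)"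
    by (simp add: cover_def)
  also have "\<dots> = (\<integral>t. indicator {-m..m} t * normal_density u \<sigma> t \<partial>lborel)"
    unfolding gaussian_def by (subst integral_density) (auto simp: mult.commute)
  finally show ?thesis .
qed

lemma measurable_cover [measurable]: "cover m \<sigma> \<in> borel_measurable borel"
  unfolding cover_eq_integral[abs_def] normal_density_def by measurable

lemma cover_le_1: "0 < \<sigma> \<Longrightarrow> cover m \<sigma> u \<le> 1"
  unfolding cover_def by (intro prob_space.prob_le_1 prob_space_gaussian)

text \<open>
  On \<open>[-m, m]\<close> the exponent of the density is at least \<open>-(m\<^sup>2 + u\<^sup>2) / \<sigma>\<^sup>2\<close>, because
  \<open>(t - u)\<^sup>2 \<le> 2 (t\<^sup>2 + u\<^sup>2)\<close>. A Gaussian lower bound is what keeps \<open>ln (cover m \<sigma> u)\<close> from falling faster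
  than quadratically.
\<close>
lemma cover_lower_bound:
  assumes "0 < m" "0 < \<sigma>"
  shows "2 * m * (1 / sqrt (2 * pi * \<sigma>\<^sup>2) * exp (- ((m\<^sup>2 + u\<^sup>2) / \<sigma>\<^sup>2))) \<le> cover m \<sigma> u"
proof -
  let ?c = "1 / sqrt (2 * pi * \<sigma>\<^sup>2) * exp (- ((m\<^sup>2 + u\<^sup>2) / \<sigma>\<^sup>2))"
  have "2 * m * ?c = (\<integral>t. indicator {-m..m} t * ?c \<partial>lborel)"
    using assms by simp
  also have "\<dots> \<le> (\<integral>t. indicator {-m..m} t * normal_density u \<sigma> t \<partial>lborel)"
  proof (rule integral_mono)
    show "integrable lborel (\<lambda>t. indicator {-m..m} t * ?c)"
      by (intro integrable_mult_left integrable_real_indicator) (simp_all add: emeasure_lborel_Icc_eq)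
    show "integrable lborel (\<lambda>t. indicator {-m..m} t * normal_density u \<sigma> t)"
      using integrable_mult_indicator[of "{-m..m}" lborel "normal_density u \<sigma>"] assms by simp
    fix t :: real
    have "?c \<le> normal_density u \<sigma> t" if "t \<in> {-m..m}"
    proof -
      have "t\<^sup>2 \<le> m\<^sup>2" using that by (auto intro!: abs_le_square_iff[THEN iffD1])
      moreover have "0 \<le> (t + u)\<^sup>2" by simp
      ultimately have "(t - u)\<^sup>2 \<le> 2 * (m\<^sup>2 + u\<^sup>2)"
        by (simp add: power2_sum power2_diff)
      then have "(t - u)\<^sup>2 / (2 * \<sigma>\<^sup>2) \<le> (m\<^sup>2 + u\<^sup>2) / \<sigma>\<^sup>2"
        using assms by (simp add: field_simps)
      then show ?thesis
        unfolding normal_density_def by (intro mult_left_mono) simp_all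
    qed
    then show "indicator {-m..m} t * ?c \<le> indicator {-m..m} t * normal_density u \<sigma> t"
      by (auto split: split_indicator)
  qed
  finally show ?thesis by (simp add: cover_eq_integral)
qed

lemma cover_pos:
  assumes "0 < m" "0 < \<sigma>"
  shows "0 < cover m \<sigma> u"
  by (rule less_le_trans[OF _ cover_lower_bound[OF assms]]) (use assms in auto)

lemma quadratic_growth_ln_cover:
  assumes "0 < m" "0 < \<sigma>"
  shows "quadratic_growth (\<lambda>u. ln (cover m \<sigma> u))"
proof (rule quadratic_growthI)
  fix u :: real
  define K where "K = 2 * m * (1 / sqrt (2 * pi * \<sigma>\<^sup>2))"
  have K: "0 < K" using assms by (simp add: K_def)
  have "ln K - (m\<^sup>2 + u\<^sup>2) / \<sigma>\<^sup>2 = ln (K * exp (- ((m\<^sup>2 + u\<^sup>2) / \<sigma>\<^sup>2)))"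
    using K by (simp add: ln_mult)
  also have "\<dots> \<le> ln (cover m \<sigma> u)"
    using cover_lower_bound[OF assms, of u] K
    by (intro ln_mono mult_pos_pos) (simp_all add: K_def mult.assoc)
  finally have "ln K - (m\<^sup>2 + u\<^sup>2) / \<sigma>\<^sup>2 \<le> ln (cover m \<sigma> u)" .
  moreover have "ln (cover m \<sigma> u) \<le> 0"
    using cover_pos[OF assms] cover_le_1[OF assms(2)] by simp
  ultimately show "\<bar>ln (cover m \<sigma> u)\<bar> \<le> (\<bar>ln K\<bar> + m\<^sup>2 / \<sigma>\<^sup>2) + 1 / \<sigma>\<^sup>2 * (norm u)\<^sup>2"
    by (simp add: add_divide_distrib)
qed

text \<open>
  Standardising turns a fixed interval seen from a moving centre into a moving interval
  under a fixed law; \<open>\<sigma>\<close> enters only through the signed distances \<open>(m + \<delta>) / \<sigma>\<close> and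
  \<open>(m - \<delta>) / \<sigma>\<close> of its ends from \<open>-z\<close>.
\<close>
lemma cover_standardized:
  assumes "0 < \<sigma>"
  shows "cover m \<sigma> (\<delta> + \<sigma> * z) = measure (gaussian 0 1) {(-m - \<delta>) / \<sigma> - z..(m - \<delta>) / \<sigma> - z}"
proof -
  have "cover m \<sigma> (\<delta> + \<sigma> * z) = measure (gaussian 0 1) ((\<lambda>t. (\<delta> + \<sigma> * z) + \<sigma> * t) -` {-m..m})"
    unfolding cover_def by (subst gaussian_affine[OF assms]) (subst measure_distr; simp)
  also have "(\<lambda>t. (\<delta> + \<sigma> * z) + \<sigma> * t) -` {-m..m} = {(-m - \<delta>) / \<sigma> - z..(m - \<delta>) / \<sigma> - z}"
    using assms by (auto simp: field_simps)
  finally show ?thesis .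
qed

text \<open>
  The heart of the argument. The restriction \<open>|\<delta>| \<le> m\<close> makes the distances \<open>(m + \<delta>) / s\<close> and \<open>(m - \<delta>) / s\<close>
  of the ends of the standardised interval from \<open>-z\<close> nonnegative, hence nonincreasing in \<open>s\<close>; for
  \<open>|\<delta>| > m\<close> one end would move the wrong way. As the two distances add up to \<open>2 m / s\<close>, at least one
  of them decreases strictly.
\<close>
lemma cover_less:
  assumes "0 < m" "\<bar>\<delta>\<bar> \<le> m" "0 < \<sigma>" "\<sigma> < \<tau>"
  shows "cover m \<tau> (\<delta> + \<tau> * z) < cover m \<sigma> (\<delta> + \<sigma> * z)"
proof -
  have \<tau>: "0 < \<tau>" using assms by linarith
  have le: "x / \<tau> \<le> x / \<sigma>" if "0 \<le> x" for x
    using that assms by (intro divide_left_mono) auto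
  have less: "x / \<tau> < x / \<sigma>" if "0 < x" for x
    using that assms by (intro divide_strict_left_mono) auto
  have l: "(-m - \<delta>) / s = - ((m + \<delta>) / s)" for s
    by (simp add: minus_divide_left)
  have nonneg: "0 \<le> m + \<delta>" "0 \<le> m - \<delta>" using assms by auto
  have "0 < m + \<delta> \<or> 0 < m - \<delta>" using assms by linarith
  then have "(m + \<delta>) / \<tau> < (m + \<delta>) / \<sigma> \<or> (m - \<delta>) / \<tau> < (m - \<delta>) / \<sigma>" using less by blast
  then show ?thesis
    unfolding cover_standardized[OF \<tau>] cover_standardized[OF assms(3)] l
    using le[OF nonneg(1)] le[OF nonneg(2)] divide_nonneg_pos[OF nonneg(1) \<tau>] divide_nonneg_pos[OF nonneg(2) \<tau>]
    by (intro gaussian_interval_less) auto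
qed

lemma integrable_ln_cover:
  assumes "0 < m" "0 < \<sigma>" "0 < \<tau>"
  shows "integrable (gaussian \<delta> \<tau>) (\<lambda>u. ln (cover m \<sigma> u))"
  by (rule integrable_gaussian_quadratic_growth[OF assms(3) _ quadratic_growth_ln_cover[OF assms(1,2)]]) measurable

lemma expected_ln_cover_less:
  assumes "0 < m" "\<bar>\<delta>\<bar> \<le> m" "0 < \<sigma>" "\<sigma> < \<tau>"
  shows "(\<integral>u. ln (cover m \<tau> u) \<partial>gaussian \<delta> \<tau>) < (\<integral>u. ln (cover m \<sigma> u) \<partial>gaussian \<delta> \<sigma>)"
proof -
  interpret prob_space "gaussian 0 1" by (rule prob_space_gaussian) simp
  have std: "integrable (gaussian 0 1) (\<lambda>z. ln (cover m s (\<delta> + s * z)))"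
    "(\<integral>u. ln (cover m s u) \<partial>gaussian \<delta> s) = (\<integral>z. ln (cover m s (\<delta> + s * z)) \<partial>gaussian 0 1)"
    if "0 < s" for s
  proof -
    have "integrable (distr (gaussian 0 1) borel (\<lambda>z. \<delta> + s * z)) (\<lambda>u. ln (cover m s u))"
      using integrable_ln_cover[OF \<open>0 < m\<close> that that] by (simp add: gaussian_affine[OF that, symmetric])
    then show "integrable (gaussian 0 1) (\<lambda>z. ln (cover m s (\<delta> + s * z)))"
      by (subst (asm) integrable_distr_eq) auto
    show "(\<integral>u. ln (cover m s u) \<partial>gaussian \<delta> s) = (\<integral>z. ln (cover m s (\<delta> + s * z)) \<partial>gaussian 0 1)"
      by (subst gaussian_affine[OF that]) (subst integral_distr; simp)
  qed
  have \<tau>: "0 < \<tau>" using assms by linarith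
  show ?thesis
    unfolding std(2)[OF assms(3)] std(2)[OF \<tau>]
  proof (rule integral_less_AE_space[OF std(1)[OF \<tau>] std(1)[OF assms(3)]])
    show "AE z in gaussian 0 1. ln (cover m \<tau> (\<delta> + \<tau> * z)) < ln (cover m \<sigma> (\<delta> + \<sigma> * z))"
      using cover_less[OF assms] cover_pos[OF assms(1)] \<tau> assms(3) by (intro AE_I2) (simp add: ln_less_cancel_iff)
    show "emeasure (gaussian 0 1) (space (gaussian 0 1)) \<noteq> 0"
      by (simp only: emeasure_space_1) simp
  qed
qed

section \<open>Dominance\<close>

text \<open>
  In the proof, \<open>E\<close> is the log-likelihood ratio of the true density to \<open>q_mre\<close> and \<open>D\<close> the logarithm of the
  Bayes correction, so the ratio to \<open>q_Bayes\<close> is \<open>E - D\<close>. The risks are the means of \<open>E\<close> and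
  \<open>E - D\<close> under the joint law of \<open>X\<close> and \<open>Y\<^sub>1\<close>; it remains to see that \<open>D\<close> has positive mean.
\<close>
lemma KL_risk_Bayes_less_mre:
  assumes s: "0 < s1" "0 < s2" "0 < sY" and m: "0 < m" and \<theta>: "\<bar>fst \<theta> - snd \<theta>\<bar> \<le> m"
  shows "KL_risk s1 s2 sY \<theta> (q_Bayes s1 s2 sY (uniform_prior {-m..m})) < KL_risk s1 s2 sY \<theta> (q_mre s1 sY)"
proof -
  define S where "S = s1\<^sup>2 + sY\<^sup>2"
  define r where "r = sqrt S"
  define \<delta> where "\<delta> = fst \<theta> - snd \<theta>"
  define \<sigma> where "\<sigma> = sqrt ((pooled_sd s1 sY)\<^sup>2 + s2\<^sup>2)"
  define \<tau> where "\<tau> = sqrt (s1\<^sup>2 + s2\<^sup>2)"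
  define V where "V = (\<lambda>z::(real \<times> real) \<times> real. fst (fst z) - snd (fst z))"
  define W where "W = (\<lambda>z::(real \<times> real) \<times> real. pooled s1 sY (fst (fst z)) (snd z) - snd (fst z))"
  define E where "E = (\<lambda>z::(real \<times> real) \<times> real. ln (Y_density sY \<theta> (snd z) / q_mre s1 sY (fst z) (snd z)))"
  define D where "D = (\<lambda>z. ln (cover m \<sigma> (W z)) - ln (cover m \<tau> (V z)))"
  let ?qB = "q_Bayes s1 s2 sY (uniform_prior {-m..m})"
  have S: "0 < S" using s by (simp add: S_def add_pos_pos)
  have r: "0 < r" using S by (simp add: r_def)
  have \<sigma>: "0 < \<sigma>" and \<tau>: "0 < \<tau>"
    using s unfolding \<sigma>_def \<tau>_def by (intro real_sqrt_gt_zero add_nonneg_pos; simp)+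
  have sd: "(pooled_sd s1 sY)\<^sup>2 = s1\<^sup>2 * sY\<^sup>2 / S"
    using S by (simp add: pooled_sd_def S_def[symmetric] power_divide power_mult_distrib)
  \<comment> \<open>Pooling with \<open>Y\<^sub>1\<close> makes the estimator of \<open>\<theta>\<^sub>1\<close> strictly more precise.\<close>
  have "\<sigma> < \<tau>"
  proof -
    have "s1\<^sup>2 * sY\<^sup>2 < s1\<^sup>2 * S" using s by (simp add: S_def)
    then show ?thesis using S by (simp add: \<sigma>_def \<tau>_def sd field_simps)
  qed

  have mre_pos: "0 < q_mre s1 sY x y" for x y
    using normal_density_pos[OF r] by (simp add: q_mre_def r_def S_def)
  have Bayes: "?qB (fst z) (snd z) = q_mre s1 sY (fst z) (snd z) * (cover m \<sigma> (W z) / cover m \<tau> (V z))" for z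
    by (simp add: q_Bayes_eq[OF s] \<sigma>_def \<tau>_def W_def V_def)
  have Bayes_pos: "0 < ?qB x y" for x y
    using Bayes[of "(x, y)"] mre_pos[of x y] cover_pos[OF m \<sigma>] cover_pos[OF m \<tau>] by simp
  have Y_pos: "0 < Y_density sY \<theta> y" for y
    using normal_density_pos[OF s(3)] by (simp add: Y_density_def)
  have E_eq: "E z = ln (normal_density (fst \<theta>) sY (snd z)) - ln (normal_density 0 r (snd z - fst (fst z)))" for z
  proof -
    have "E z = ln (Y_density sY \<theta> (snd z)) - ln (q_mre s1 sY (fst z) (snd z))"
      unfolding E_def by (rule ln_divide_pos[OF Y_pos mre_pos])
    moreover have "q_mre s1 sY (fst z) (snd z) = normal_density 0 r (snd z - fst (fst z))"
      by (simp add: q_mre_def normal_density_def r_def S_def)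
    ultimately show ?thesis by (simp add: Y_density_def)
  qed
  have log_Bayes: "ln (Y_density sY \<theta> (snd z) / ?qB (fst z) (snd z)) = E z - D z" for z
    unfolding Bayes E_def D_def
    using Y_pos[of "snd z"] mre_pos[of "fst z" "snd z"] cover_pos[OF m \<sigma>, of "W z"] cover_pos[OF m \<tau>, of "V z"]
    by (simp add: ln_div ln_mult)

  have lin: "bounded_linear V" "bounded_linear W" "bounded_linear (\<lambda>z::(real \<times> real) \<times> real. snd z - fst (fst z))"
    unfolding V_def W_def pooled_def
    by (intro bounded_linear_sub bounded_linear_add bounded_linear_const_mult bounded_linear_compose[OF bounded_linear_fst]
        bounded_linear_compose[OF bounded_linear_snd] bounded_linear_fst bounded_linear_snd)+
  have [measurable]: "V \<in> borel_measurable borel" "W \<in> borel_measurable borel"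
    "(\<lambda>z::(real \<times> real) \<times> real. snd z - fst (fst z)) \<in> borel_measurable borel"
    "(snd :: (real \<times> real) \<times> real \<Rightarrow> real) \<in> borel_measurable borel"
    using lin by (auto intro!: borel_measurable_continuous_onI linear_continuous_on bounded_linear_snd)
  have meas_E: "E \<in> borel_measurable borel" and meas_D: "D \<in> borel_measurable borel"
    unfolding E_eq[abs_def] D_def by measurable
  have growth_E: "quadratic_growth E"
    unfolding E_eq[abs_def] using s r
    by (intro quadratic_growth_diff quadratic_growth_linear[OF quadratic_growth_ln_normal_density] lin bounded_linear_snd)
  have growth_W: "quadratic_growth (\<lambda>z. ln (cover m \<sigma> (W z)))" and growth_V: "quadratic_growth (\<lambda>z. ln (cover m \<tau> (V z)))"
    by (rule quadratic_growth_linear[OF quadratic_growth_ln_cover[OF m \<sigma>] lin(2)],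
        rule quadratic_growth_linear[OF quadratic_growth_ln_cover[OF m \<tau>] lin(1)])
  have growth_D: "quadratic_growth D"
    unfolding D_def by (intro quadratic_growth_diff growth_W growth_V)
  let ?P = "XY_law s1 s2 sY \<theta>"
  have int: "integrable ?P E" "integrable ?P D"
    "integrable ?P (\<lambda>z. ln (cover m \<sigma> (W z)))" "integrable ?P (\<lambda>z. ln (cover m \<tau> (V z)))"
    by (intro integrable_XY_law s meas_E meas_D growth_E growth_D growth_W growth_V; measurable)+

  have risk_mre: "KL_risk s1 s2 sY \<theta> (q_mre s1 sY) = ereal (\<integral>z. E z \<partial>?P)"
    using KL_risk_eq[where q = "q_mre s1 sY", OF s mre_pos, of \<theta>] meas_E growth_E by (simp add: E_def)
  have risk_Bayes: "KL_risk s1 s2 sY \<theta> ?qB = ereal (\<integral>z. E z - D z \<partial>?P)"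
    using KL_risk_eq[where q = ?qB, OF s Bayes_pos, of \<theta>, unfolded log_Bayes]
      borel_measurable_diff[OF meas_E meas_D] quadratic_growth_diff[OF growth_E growth_D] by simp

  \<comment> \<open>The weights of the pooled observation add up to 1, and both \<open>X\<^sub>1\<close> and \<open>Y\<^sub>1\<close> have mean \<open>\<theta>\<^sub>1\<close>, so \<open>W\<close> is unbiased.\<close>
  have law_W: "distr ?P borel W = gaussian \<delta> \<sigma>"
  proof -
    have W: "W = (\<lambda>z. sY\<^sup>2 / S * fst (fst z) + (- 1) * snd (fst z) + s1\<^sup>2 / S * snd z)"
      by (auto simp: W_def pooled_def S_def fun_eq_iff)
    have mean: "sY\<^sup>2 / S * fst \<theta> + (- 1) * snd \<theta> + s1\<^sup>2 / S * fst \<theta> = \<delta>"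
    proof -
      have "sY\<^sup>2 / S + s1\<^sup>2 / S = S / S"
        by (subst (3) S_def) (simp add: add_divide_distrib)
      then have "sY\<^sup>2 / S + s1\<^sup>2 / S = 1" using S by simp
      then have "(sY\<^sup>2 / S + s1\<^sup>2 / S) * fst \<theta> = fst \<theta>" by simp
      then show ?thesis by (simp add: \<delta>_def distrib_right)
    qed
    have "(sY\<^sup>2 / S)\<^sup>2 * s1\<^sup>2 + (s1\<^sup>2 / S)\<^sup>2 * sY\<^sup>2 = s1\<^sup>2 * sY\<^sup>2 * S / S\<^sup>2"
      by (simp add: S_def power_divide add_divide_distrib distrib_left) (simp add: power2_eq_square power4_eq_xxxx mult_ac)
    then have var: "sqrt ((sY\<^sup>2 / S)\<^sup>2 * s1\<^sup>2 + (- 1)\<^sup>2 * s2\<^sup>2 + (s1\<^sup>2 / S)\<^sup>2 * sY\<^sup>2) = \<sigma>"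
      using S by (simp add: \<sigma>_def sd power2_eq_square[of S] add_ac)
    show ?thesis
      unfolding XY_law_def W
      by (subst gaussian_lincomb3) (use s S in \<open>auto simp: mean[simplified] var[simplified]\<close>)
  qed
  have law_V: "distr ?P borel V = gaussian \<delta> \<tau>"
  proof -
    let ?M = "gaussian (fst \<theta>) s1 \<Otimes>\<^sub>M gaussian (snd \<theta>) s2" and ?N = "gaussian (fst \<theta>) sY"
    interpret N: prob_space ?N using s by (intro prob_space_gaussian)
    have V: "V = (\<lambda>x. 1 * fst x + (- 1) * snd x) \<circ> fst" by (auto simp: V_def)
    have "distr ?P borel V = distr (distr ?P ?M fst) borel (\<lambda>x. 1 * fst x + (- 1) * snd x)"
      unfolding V by (subst distr_distr) (auto simp: XY_law_def)
    also have "distr ?P ?M fst = ?M"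
      unfolding XY_law_def by (rule N.distr_pair_fst)
    finally show ?thesis using s by (subst (asm) gaussian_lincomb) (auto simp: \<delta>_def \<tau>_def)
  qed
  have "(\<integral>z. D z \<partial>?P) = (\<integral>z. ln (cover m \<sigma> (W z)) \<partial>?P) - (\<integral>z. ln (cover m \<tau> (V z)) \<partial>?P)"
    unfolding D_def using int by simp
  also have "(\<integral>z. ln (cover m \<sigma> (W z)) \<partial>?P) = (\<integral>u. ln (cover m \<sigma> u) \<partial>gaussian \<delta> \<sigma>)"
    unfolding law_W[symmetric] by (subst integral_distr) auto
  also have "(\<integral>z. ln (cover m \<tau> (V z)) \<partial>?P) = (\<integral>u. ln (cover m \<tau> u) \<partial>gaussian \<delta> \<tau>)"
    unfolding law_V[symmetric] by (subst integral_distr) auto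
  finally have "0 < (\<integral>z. D z \<partial>?P)"
    using expected_ln_cover_less[of m \<delta> \<sigma> \<tau>] m \<theta> \<sigma> \<open>\<sigma> < \<tau>\<close> by (simp add: \<delta>_def)
  then show ?thesis
    unfolding risk_mre risk_Bayes using int by simp
qed

theorem theorem4p2:
  fixes s1 s2 sY m :: real
  assumes "s1 > 0" and "s2 > 0" and "sY > 0" and "m > 0"
  shows "strictly_dominates s1 s2 sY {-m..m}
           (q_Bayes s1 s2 sY (uniform_prior {-m..m})) (q_mre s1 sY)"
proof -
  have "KL_risk s1 s2 sY \<theta> (q_Bayes s1 s2 sY (uniform_prior {-m..m})) < KL_risk s1 s2 sY \<theta> (q_mre s1 sY)"
    if "\<theta> \<in> param_space {-m..m}" for \<theta>
    using that assms by (intro KL_risk_Bayes_less_mre) (auto simp: param_space_def)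
  \<comment> \<open>Strict dominance also asks for one parameter with strict inequality, so the parameter space must be nonempty.\<close>
  moreover have "(0, 0) \<in> param_space {-m..m}"
    using assms by (simp add: param_space_def)
  ultimately show ?thesis
    unfolding strictly_dominates_def dominates_def by (meson less_imp_le)
qed

end
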